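(* There exist $\lambda_*>0$ and a constant $K$ such that for every $\lambda\in(0,\lambda_* )$ there is a domain $\Lambda\subset\Omega$ of area at most $K\lambda$, and a mapping $L$ of $\Lambda$ induced by $F$ (first-return map of $F$ to $\Lambda$), with the following properties. (1) $L$ serves as a return map for all orbits of $F$ outside the main island, apart from a set of measure $O(\lambda^2)$; that is, the set of points of $\Omega$ outside the main island whose $F$-orbit does not meet $\Lambda$ has area at most $K\lambda^2$. (2) $L$ is the composition of two piecewise isometric involutions of $\Lambda$, and each of these involutions maps each of its atoms onto itself, apart from a set of (irregular) atoms of total area at most $K\lambda^3$.
   Context: For $\lambda>0$ small let $\Omega=[0,1)^2$ and let $F:\Omega\to\Omega$, $F(x,y)=(\lambda x-y+\iota(x,y),\,x)$ with $\iota(x,y)=-\lfloor\lambda x-y\rfloor$. $F$ is an area-preserving bijection, and it is a piecewise isometry for the metric of the inner product $\mathcal Q(U,V)=U_xV_x+U_yV_y-\frac{\lambda}{2}(U_xV_y+U_yV_x)$; "isometry" refers to this metric. The main island is the closed region bounded by the ellipse $\mathcal E=\{z:\mathcal Q(z-c,z-c)=(1-\lambda^2/4)\left(\frac{1-\lambda}{2-\lambda}\right)^2\}$ centred at the fixed point $c=\left(\frac1{2-\lambda},\frac1{2-\lambda}\right)$ of $F$; $\mathcal E$ is tangent to the lines $x=1$ and $y=1$. Induced maps are understood to be defined up to sets of measure zero (orbits that do not return are ignored). Each of the two involutions is built from iterates of $F$ and the reflection $G(x,y)=(y,x)$. The number of iterates of $F$ used at a point is its transit time. An atom of such an involution is a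 maximal connected subset of $\Lambda$ on which the transit time, and the sequence of values of $\iota$ along the corresponding orbit segment of $F$, are constant; on an atom the involution is the restriction of an isometry. *)

theory Defs
  imports "HOL-Analysis.Analysis"
begin

type_synonym point = "real \<times> real"

definition Omega :: "point set" where
  "Omega = {0..<1} \<times> {0..<1}"

definition iota :: "real \<Rightarrow> point \<Rightarrow> int" where
  "iota lam z = - \<lfloor>lam * fst z - snd z\<rfloor>"

definition F :: "real \<Rightarrow> point \<Rightarrow> point" where
  "F lam z = (lam * fst z - snd z + of_int (iota lam z), fst z)"

definition G :: "point \<Rightarrow> point" where
  "G z = (snd z, fst z)"

definition Q :: "real \<Rightarrow> point \<Rightarrow> point \<Rightarrow> real" where
  "Q lam U V = fst U * fst V + snd U * snd V - lam / 2 * (fst U * snd V + snd U * fst V)"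

definition Q_isometry :: "real \<Rightarrow> (point \<Rightarrow> point) \<Rightarrow> bool" where
  "Q_isometry lam T \<longleftrightarrow>
     (\<forall>u v. Q lam (T u - T v) (T u - T v) = Q lam (u - v) (u - v))"

definition centre :: "real \<Rightarrow> point" where
  "centre lam = (1 / (2 - lam), 1 / (2 - lam))"

definition main_island :: "real \<Rightarrow> point set" where
  "main_island lam =
     {z. Q lam (z - centre lam) (z - centre lam)
           \<le> (1 - lam\<^sup>2 / 4) * ((1 - lam) / (2 - lam))\<^sup>2}"

(* Measurability is part of the bound: the measure of a non-measurable set is 0 by convention. *)
definition area_le :: "point set \<Rightarrow> real \<Rightarrow> bool" where
  "area_le S a \<longleftrightarrow> S \<in> lmeasurable \<and> measure lebesgue S \<le> a"

(* A region of the plane: no thin or isolated parts, but no condition on which boundary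
   points belong to it, and not necessarily connected. *)
definition planar_domain :: "point set \<Rightarrow> bool" where
  "planar_domain S \<longleftrightarrow> S \<noteq> {} \<and> S \<in> sets lebesgue \<and> S \<subseteq> closure (interior S)"

(* Two-sided orbit: F is a bijection of Omega. *)
definition F_orbit :: "real \<Rightarrow> point \<Rightarrow> point set" where
  "F_orbit lam z = {w \<in> Omega. \<exists>n. (F lam ^^ n) z = w \<or> (F lam ^^ n) w = z}"

definition returns :: "real \<Rightarrow> point set \<Rightarrow> point \<Rightarrow> bool" where
  "returns lam \<Lambda> z \<longleftrightarrow> (\<exists>n>0. (F lam ^^ n) z \<in> \<Lambda>)"

(* Meaningful only at points satisfying returns. *)
definition first_return :: "real \<Rightarrow> point set \<Rightarrow> point \<Rightarrow> point" where
  "first_return lam \<Lambda> z = (F lam ^^ (LEAST n. n > 0 \<and> (F lam ^^ n) z \<in> \<Lambda>)) z"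

(* Since G o F o G is the inverse of F on Omega, any word in F, its inverse and G that contains
   an odd number of G's reduces to a single block of forward iterates of F with one reflection
   before it or after it. *)
datatype reflection_place = Reflect_First | Reflect_Last

definition segment_start :: "reflection_place \<Rightarrow> point \<Rightarrow> point" where
  "segment_start p z = (case p of Reflect_First \<Rightarrow> G z | Reflect_Last \<Rightarrow> z)"

definition transit_map ::
  "real \<Rightarrow> reflection_place \<Rightarrow> (point \<Rightarrow> nat) \<Rightarrow> point \<Rightarrow> point" where
  "transit_map lam p t z =
     (case p of Reflect_First \<Rightarrow> (F lam ^^ t z) (G z)
              | Reflect_Last \<Rightarrow> G ((F lam ^^ t z) z))"

definition transit_code ::
  "real \<Rightarrow> reflection_place \<Rightarrow> (point \<Rightarrow> nat) \<Rightarrow> point \<Rightarrow> int list" where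
  "transit_code lam p t z =
     map (\<lambda>k. iota lam ((F lam ^^ k) (segment_start p z))) [0..<t z]"

definition atoms ::
  "real \<Rightarrow> reflection_place \<Rightarrow> (point \<Rightarrow> nat) \<Rightarrow> point set \<Rightarrow> point set set" where
  "atoms lam p t D =
     (\<Union>z\<in>D. components {w \<in> D. t w = t z \<and> transit_code lam p t w = transit_code lam p t z})"

(* D is the subset of full measure of \<Lambda> on which the involution is defined. *)
definition pw_isometric_involution ::
  "real \<Rightarrow> point set \<Rightarrow> point set \<Rightarrow> reflection_place \<Rightarrow> (point \<Rightarrow> nat) \<Rightarrow> bool" where
  "pw_isometric_involution lam \<Lambda> D p t \<longleftrightarrow>
     D \<subseteq> \<Lambda> \<and> negligible (\<Lambda> - D) \<and>
     (\<forall>z\<in>D. transit_map lam p t z \<in> D \<and> transit_map lam p t (transit_map lam p t z) = z) \<and>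
     (\<forall>A\<in>atoms lam p t D. \<exists>T. Q_isometry lam T \<and> (\<forall>z\<in>A. transit_map lam p t z = T z))"

definition irregular_part ::
  "real \<Rightarrow> reflection_place \<Rightarrow> (point \<Rightarrow> nat) \<Rightarrow> point set \<Rightarrow> point set" where
  "irregular_part lam p t D = \<Union>{A \<in> atoms lam p t D. transit_map lam p t ` A \<noteq> A}"

end

theory Submission
  imports Defs
begin

text \<open>
  Write \<open>W\<close> for the wedge \<open>y \<le> \<lambda>x\<close> of \<open>\<Omega>\<close>, a triangle of area \<open>\<lambda>/2\<close>. It is the
  set where \<open>\<iota> = 0\<close>; on the rest of \<open>\<Omega>\<close> one has \<open>\<iota> = 1\<close>, and \<open>F\<close> is one elliptic
  rotation about the fixed point \<open>c\<close>. The domain \<open>\<Lambda>\<close> is \<open>W\<close> itself.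

  Reversibility: \<open>G F\<close> is an involution of \<open>\<Omega>\<close>, and on \<open>W\<close> it is the linear map
  \<open>(x, y) \<mapsto> (x, \<lambda>x - y)\<close>, which maps \<open>W\<close> onto itself. Therefore \<open>F(W) = G(W)\<close>, and the first return
  of \<open>z \<in> W\<close> is the flip \<open>w = G (F z)\<close> followed by the crossing \<open>w \<mapsto> F^n (G w)\<close>, where \<open>n\<close> is the
  first time at which the orbit of \<open>G w\<close> is in \<open>W\<close>. The crossing is an involution because \<open>G\<close>
  conjugates \<open>F\<close> to its inverse, so that the orbit segment from \<open>G(W)\<close> to \<open>W\<close> read backwards and
  reflected is again such a segment, of the same length.

  Atoms: the flip has the single atom \<open>W\<close>. For the crossing, every \<open>\<iota>\<close>-value along the segment is
  \<open>1\<close>, so only the transit time matters. The points of transit time \<open>n\<close> are cut out by the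
  conditions that the first \<open>n\<close> images under the rotation are in the convex set \<open>\<Omega> - W\<close> and the next
  one is in the convex set \<open>W\<close>. Such a set is an intersection of affine preimages of convex sets,
  hence convex, hence connected: it is one atom, and the crossing preserves it because it preserves
  the transit time. There are no irregular atoms at all (lemma \<open>crossing_irregular_part\<close>).

  Exceptional sets: an orbit that leaves \<open>W\<close> and never returns is a forward orbit of the rotation
  inside the bounded set \<open>\<Omega>\<close>. A rotation is recurrent, so such an orbit would come back arbitrarily
  close to the preimage of its first point under the rotation, which lies outside the closed unit
  square unless the point is on one line; this is lemma \<open>crossing_domainI\<close>. A point
  whose orbit never meets \<open>W\<close> also has a forward orbit that is a rotation orbit in \<open>x < 1\<close>. The fourth
  power of the rotation turns by an angle \<open>2h\<close> with \<open>cos h = 1 - \<lambda>^2/2\<close>, so some iterate comes within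
  angle \<open>h\<close> of the direction in which the ellipse is tangent to \<open>x = 1\<close>. The point is therefore within
  a factor \<open>1/cos h = 1 + O(\<lambda>^2)\<close> of the main island
  (lemma \<open>bounded_rotation_orbit_in_ellipse\<close>), and the annulus has area \<open>O(\<lambda>^2)\<close>.
\<close>

section \<open>The wedge and the rotation\<close>

definition wedge :: "real \<Rightarrow> point set" where
  "wedge lam = {z \<in> Omega. snd z \<le> lam * fst z}"

text \<open>
  The branch \<open>\<iota> = 1\<close> of \<open>F\<close>, extended to an affine rotation of the whole plane about the centre of the
  main island.
\<close>

definition rot :: "real \<Rightarrow> point \<Rightarrow> point" where
  "rot lam z = (lam * fst z - snd z + 1, fst z)"

lemma G_G [simp]: "G (G z) = z"
  by (simp add: G_def)

lemma G_in_Omega [simp]: "G z \<in> Omega \<longleftrightarrow> z \<in> Omega"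
  by (cases z) (auto simp: Omega_def G_def)

lemma wedge_in_Omega: "z \<in> wedge lam \<Longrightarrow> z \<in> Omega"
  by (simp add: wedge_def)

lemma F_in_Omega: "z \<in> Omega \<Longrightarrow> F lam z \<in> Omega"
  using real_of_int_floor_add_one_gt[of "lam * fst z - snd z"]
  by (simp add: Omega_def F_def iota_def mem_Times_iff del: real_of_int_floor_add_one_gt)

lemma funpow_F_in_Omega: "z \<in> Omega \<Longrightarrow> (F lam ^^ n) z \<in> Omega"
  by (induction n) (auto intro: F_in_Omega)

text \<open>
  This is the reversibility of \<open>F\<close>: on \<open>\<Omega>\<close>, adding the integer \<open>\<iota>\<close> only takes a fractional part, and
  both applications of \<open>F\<close> keep the coordinate that the reflection puts first.
\<close>

lemma G_F_involution:
  assumes "z \<in> Omega"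
  shows "G (F lam (G (F lam z))) = z"
proof -
  define x y k where "x = fst z" and "y = snd z" and "k = \<lfloor>lam * x - y\<rfloor>"
  have y: "0 \<le> y" "y < 1"
    using assms by (auto simp: Omega_def y_def)
  have "\<lfloor>lam * x - (lam * x - y - of_int k)\<rfloor> = k"
    using y by (intro floor_unique) auto
  then show ?thesis
    by (simp add: F_def G_def iota_def x_def y_def k_def prod_eq_iff)
qed

lemma funpow_F_reversal:
  assumes "z \<in> Omega"
  shows "(F lam ^^ n) (G ((F lam ^^ n) z)) = G z"
proof (induction n)
  case (Suc n)
  have *: "F lam (G (F lam u)) = G u" if "u \<in> Omega" for u
    using G_F_involution[OF that, of lam] by (metis G_G)
  have "(F lam ^^ Suc n) (G ((F lam ^^ Suc n) z))
      = (F lam ^^ n) (F lam (G (F lam ((F lam ^^ n) z))))"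
    by (simp add: funpow_swap1)
  also have "\<dots> = G z"
    using * funpow_F_in_Omega[OF assms] Suc by simp
  finally show ?case .
qed simp

text \<open>
  Backward orbits are mirror images of forward orbits. This is how points with a prescribed \<open>n\<close>-th
  image are found, and how backward orbits are made measurable functions of the point.
\<close>

lemma funpow_F_eq_iff:
  assumes "w \<in> Omega" "z \<in> Omega"
  shows "(F lam ^^ n) w = z \<longleftrightarrow> w = G ((F lam ^^ n) (G z))"
  using funpow_F_reversal[OF assms(1), of n lam] funpow_F_reversal[of "G z" n lam] assms
  by (metis G_G G_in_Omega)

lemma convex_wedge: "convex (wedge lam)"
proof -
  have "wedge lam = {0..<1} \<times> {0..<1} \<inter> {z. inner (- lam, 1) z \<le> 0}"
    by (auto simp: wedge_def Omega_def inner_prod_def)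
  then show ?thesis
    by (auto intro!: convex_Int convex_Times convex_real_interval convex_halfspace_le)
qed

text \<open>
  Both pieces of \<open>\<Omega>\<close> are intersections of a square with a half-plane. Convexity of the larger piece
  is what makes the sets of constant transit time convex.
\<close>

lemma convex_off_wedge: "convex (Omega - wedge lam)"
proof -
  have "Omega - wedge lam = {0..<1} \<times> {0..<1} \<inter> {z. inner (- lam, 1) z > 0}"
    by (auto simp: wedge_def Omega_def inner_prod_def)
  then show ?thesis
    by (auto intro!: convex_Int convex_Times convex_real_interval convex_halfspace_gt)
qed

locale small_parameter =
  fixes lam :: real
  assumes lam: "0 < lam" "lam < 1"

context small_parameter
begin

lemma F_on_wedge:
  assumes "z \<in> wedge lam"
  shows "iota lam z = 0" "F lam z = (lam * fst z - snd z, fst z)"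
proof -
  have "lam * fst z < 1"
    using assms lam mult_strict_mono[of lam 1 "fst z" 1] by (auto simp: wedge_def Omega_def)
  then have "\<lfloor>lam * fst z - snd z\<rfloor> = 0"
    using assms by (intro floor_unique) (auto simp: wedge_def Omega_def)
  then show "iota lam z = 0" "F lam z = (lam * fst z - snd z, fst z)"
    by (auto simp: F_def iota_def)
qed

lemma F_off_wedge:
  assumes "z \<in> Omega - wedge lam"
  shows "iota lam z = 1" "F lam z = rot lam z"
proof -
  have "0 \<le> lam * fst z"
    using assms lam by (auto simp: Omega_def)
  then have "\<lfloor>lam * fst z - snd z\<rfloor> = -1"
    using assms by (intro floor_unique) (auto simp: wedge_def Omega_def)
  then show "iota lam z = 1" "F lam z = rot lam z"
    by (auto simp: F_def rot_def iota_def)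
qed

lemma G_F_on_wedge:
  assumes "z \<in> wedge lam"
  shows "G (F lam z) = (fst z, lam * fst z - snd z)"
  using F_on_wedge[OF assms] by (simp add: G_def)

text \<open>
  Since \<open>G\<close> is an involution, this says that \<open>F\<close> maps the wedge into its mirror image: every orbit
  that leaves the wedge starts its passage in \<open>G(W)\<close>.
\<close>

lemma G_F_wedge:
  assumes "z \<in> wedge lam"
  shows "G (F lam z) \<in> wedge lam"
proof -
  have "lam * fst z < 1"
    using assms lam mult_strict_mono[of lam 1 "fst z" 1] by (auto simp: wedge_def Omega_def)
  then show ?thesis
    using assms by (auto simp: G_F_on_wedge wedge_def Omega_def)
qed

text \<open>
  The two directions of the same comparison: as long as the orbit, whether computed with \<open>F\<close> or with
  the rotation, has not met the wedge, \<open>F\<close> acts as the rotation. The set of points with a given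
  transit time is thereby described by the rotation alone.
\<close>

lemma funpow_rot_eq_F:
  assumes "\<And>j. j < n \<Longrightarrow> (F lam ^^ j) z \<in> Omega - wedge lam"
  shows "(rot lam ^^ n) z = (F lam ^^ n) z"
  using assms
proof (induction n)
  case (Suc n)
  have "(rot lam ^^ n) z = (F lam ^^ n) z"
    using Suc by simp
  then show ?case
    using F_off_wedge(2)[OF Suc.prems[of n]] by simp
qed simp

lemma funpow_F_eq_rot:
  assumes "\<And>j. j < n \<Longrightarrow> (rot lam ^^ j) z \<in> Omega - wedge lam"
  shows "(F lam ^^ n) z = (rot lam ^^ n) z"
  using assms
proof (induction n)
  case (Suc n)
  have "(F lam ^^ n) z = (rot lam ^^ n) z"
    using Suc by simp
  then show ?case
    using F_off_wedge(2)[of "(rot lam ^^ n) z"] Suc.prems[of n] by simp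
qed simp

end

section \<open>The two involutions\<close>

text \<open>
  The orbit starts at \<open>G w\<close>, which lies in the \<open>F\<close>-image of the wedge. Transit time \<open>0\<close> is allowed; it
  occurs only at the corner, which lies in the wedge and in its mirror image.
\<close>

definition crossing_domain :: "real \<Rightarrow> point set" where
  "crossing_domain lam = {w \<in> wedge lam. \<exists>n. (F lam ^^ n) (G w) \<in> wedge lam}"

definition crossing_time :: "real \<Rightarrow> point \<Rightarrow> nat" where
  "crossing_time lam w = (LEAST n. (F lam ^^ n) (G w) \<in> wedge lam)"

lemma Q_isometry_funpow_rot_G: "Q_isometry lam (\<lambda>z. (rot lam ^^ n) (G z))"
proof (induction n)
  case 0
  then show ?case
    by (auto simp: Q_isometry_def Q_def G_def algebra_simps)
next
  case (Suc n)
  have "Q lam (rot lam u - rot lam v) (rot lam u - rot lam v) = Q lam (u - v) (u - v)" for u v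
    by (simp add: Q_def rot_def field_simps)
  then show ?case
    using Suc by (simp add: Q_isometry_def)
qed

lemma funpow_rot_G_affine:
  assumes "u + v = 1"
  shows "(rot lam ^^ n) (G (u *\<^sub>R a + v *\<^sub>R b))
       = u *\<^sub>R (rot lam ^^ n) (G a) + v *\<^sub>R (rot lam ^^ n) (G b)"
proof (induction n)
  case 0
  then show ?case by (simp add: G_def)
next
  case (Suc n)
  have "rot lam (u *\<^sub>R a + v *\<^sub>R b) = u *\<^sub>R rot lam a + v *\<^sub>R rot lam b" for a b
    using assms by (simp add: rot_def algebra_simps)
  then show ?case
    using Suc by simp
qed

lemma convex_vimage_funpow_rot_G:
  assumes "convex S"
  shows "convex {z. (rot lam ^^ n) (G z) \<in> S}"
  using assms by (auto simp: convex_def funpow_rot_G_affine)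

lemma crossing_time_hits:
  "w \<in> crossing_domain lam \<Longrightarrow> (F lam ^^ crossing_time lam w) (G w) \<in> wedge lam"
  unfolding crossing_time_def crossing_domain_def by (auto intro: LeastI)

lemma before_crossing_time:
  assumes "w \<in> crossing_domain lam" "j < crossing_time lam w"
  shows "(F lam ^^ j) (G w) \<in> Omega - wedge lam"
  using assms not_less_Least[of j "\<lambda>n. (F lam ^^ n) (G w) \<in> wedge lam"]
  by (auto simp: crossing_time_def crossing_domain_def wedge_in_Omega funpow_F_in_Omega)

lemma transit_map_crossing:
  "transit_map lam Reflect_First (crossing_time lam) w = (F lam ^^ crossing_time lam w) (G w)"
  by (simp add: transit_map_def)

lemma transit_map_flip: "transit_map lam Reflect_Last (\<lambda>_. 1) z = G (F lam z)"
  by (simp add: transit_map_def)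

lemma irregular_part_empty:
  assumes "\<And>A. A \<in> atoms lam p t D \<Longrightarrow> transit_map lam p t ` A = A"
  shows "irregular_part lam p t D = {}"
  using assms unfolding irregular_part_def by blast

context small_parameter
begin

text \<open>
  The reversed and reflected orbit segment leads from \<open>G u\<close> back to \<open>w\<close> in the same number of steps.
  No shorter passage from \<open>G u\<close> exists: an early visit to the wedge would correspond to an early visit
  of the original segment to the mirror image of the wedge, and one step before that the segment
  would have been in the wedge.
\<close>

lemma crossing_involution:
  assumes w: "w \<in> crossing_domain lam"
  defines "u \<equiv> (F lam ^^ crossing_time lam w) (G w)"
  shows "u \<in> crossing_domain lam" "crossing_time lam u = crossing_time lam w"
    "(F lam ^^ crossing_time lam w) (G u) = w"
proof -
  define n where "n = crossing_time lam w"
  have wO: "w \<in> Omega" and ww: "w \<in> wedge lam"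
    using w by (auto simp: crossing_domain_def wedge_in_Omega)
  have uw: "u \<in> wedge lam"
    using crossing_time_hits[OF w] by (simp add: u_def)
  have backwards: "(F lam ^^ n) (G u) = w"
    using funpow_F_reversal[of "G w" n lam] wO by (simp add: u_def n_def)
  show ud: "u \<in> crossing_domain lam"
    using uw backwards ww unfolding crossing_domain_def by blast
  show same: "crossing_time lam u = crossing_time lam w"
  proof (rule antisym)
    show "crossing_time lam u \<le> crossing_time lam w"
      using Least_le[of "\<lambda>n. (F lam ^^ n) (G u) \<in> wedge lam" n] backwards ww n_def
      by (simp add: crossing_time_def[of lam u])
    show "crossing_time lam w \<le> crossing_time lam u"
    proof (rule ccontr)
      assume "\<not> crossing_time lam w \<le> crossing_time lam u"
      define k where "k = crossing_time lam u"
      define v where "v = (F lam ^^ k) (G u)"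
      have "k < n"
        using \<open>\<not> crossing_time lam w \<le> crossing_time lam u\<close> by (simp add: k_def n_def)
      then obtain m where m: "n = k + Suc m"
        using less_iff_Suc_add by auto
      have vw: "v \<in> wedge lam"
        using crossing_time_hits[OF ud] by (simp add: v_def k_def)
      have "(F lam ^^ k) ((F lam ^^ Suc m) (G w)) = u"
        unfolding u_def n_def[symmetric] m funpow_add by simp
      then have "F lam ((F lam ^^ m) (G w)) = G v"
        using funpow_F_eq_iff[of "(F lam ^^ Suc m) (G w)" u k lam] wO uw
        by (simp add: v_def wedge_in_Omega funpow_F_in_Omega F_in_Omega)
      \<comment> \<open>\<open>G\<close> of the wedge is the \<open>F\<close>-image of the wedge, so the orbit was in the wedge one step
        before it reached \<open>G v\<close>.\<close>
      then have "(F lam ^^ m) (G w) = G (F lam v)"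
        using G_F_involution[of "(F lam ^^ m) (G w)" lam] wO by (simp add: funpow_F_in_Omega)
      then have "(F lam ^^ m) (G w) \<in> wedge lam"
        using G_F_wedge[OF vw] by simp
      then show False
        using before_crossing_time[OF w, of m] m n_def by simp
    qed
  qed
  show "(F lam ^^ crossing_time lam w) (G u) = w"
    using backwards n_def by simp
qed

lemma crossing_code:
  assumes "w \<in> crossing_domain lam"
  shows "transit_code lam Reflect_First (crossing_time lam) w = replicate (crossing_time lam w) 1"
proof (rule nth_equalityI)
  fix i assume "i < length (transit_code lam Reflect_First (crossing_time lam) w)"
  then show "transit_code lam Reflect_First (crossing_time lam) w ! i = replicate (crossing_time lam w) 1 ! i"
    using F_off_wedge(1)[OF before_crossing_time[OF assms]]
    by (simp add: transit_code_def segment_start_def)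
qed (simp add: transit_code_def)

text \<open>
  The first-hitting conditions on \<open>F\<close> become conditions on the affine maps \<open>rot^j G\<close>, each with a
  convex target.
\<close>

lemma crossing_level_set:
  "{w \<in> crossing_domain lam. crossing_time lam w = n}
   = wedge lam \<inter> (\<Inter>j<n. {w. (rot lam ^^ j) (G w) \<in> Omega - wedge lam})
               \<inter> {w. (rot lam ^^ n) (G w) \<in> wedge lam}" (is "?L = ?A")
proof (intro equalityI subsetI)
  fix w assume "w \<in> ?L"
  then have w: "w \<in> crossing_domain lam" "crossing_time lam w = n" by auto
  have eq: "(rot lam ^^ j) (G w) = (F lam ^^ j) (G w)" if "j \<le> n" for j
    using before_crossing_time[OF w(1)] w(2) that by (intro funpow_rot_eq_F) auto
  have "w \<in> wedge lam"
    using w(1) by (simp add: crossing_domain_def)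
  moreover have "(rot lam ^^ j) (G w) \<in> Omega - wedge lam" if "j < n" for j
    using before_crossing_time[OF w(1)] w(2) eq[of j] that by simp
  moreover have "(rot lam ^^ n) (G w) \<in> wedge lam"
    using crossing_time_hits[OF w(1)] w(2) eq[of n] by simp
  ultimately show "w \<in> ?A"
    by blast
next
  fix w assume w: "w \<in> ?A"
  have eq: "(F lam ^^ j) (G w) = (rot lam ^^ j) (G w)" if "j \<le> n" for j
    using w that by (intro funpow_F_eq_rot) auto
  have "w \<in> crossing_domain lam"
    unfolding crossing_domain_def using w eq[of n] by (auto intro!: exI[of _ n])
  moreover have "crossing_time lam w = n"
    unfolding crossing_time_def
  proof (rule Least_equality)
    show "(F lam ^^ n) (G w) \<in> wedge lam"
      using w eq by simp
    show "n \<le> m" if "(F lam ^^ m) (G w) \<in> wedge lam" for m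
      using w eq[of m] that by (cases "m < n") auto
  qed
  ultimately show "w \<in> ?L" by simp
qed

lemma convex_crossing_level_set: "convex {w \<in> crossing_domain lam. crossing_time lam w = n}"
  unfolding crossing_level_set
  by (intro convex_Int convex_INT convex_vimage_funpow_rot_G convex_wedge convex_off_wedge)

text \<open>
  The codes are constant sequences of \<open>1\<close>, so they give no refinement of the level sets of the transit
  time, and a convex level set has only one component.
\<close>

lemma atoms_crossing:
  "atoms lam Reflect_First (crossing_time lam) (crossing_domain lam)
   = (\<lambda>z. {w \<in> crossing_domain lam. crossing_time lam w = crossing_time lam z}) ` crossing_domain lam"
proof -
  define level where "level z = {w \<in> crossing_domain lam. crossing_time lam w = crossing_time lam z}"
    for z
  have code: "{w \<in> crossing_domain lam. crossing_time lam w = crossing_time lam z \<and>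
          transit_code lam Reflect_First (crossing_time lam) w
            = transit_code lam Reflect_First (crossing_time lam) z} = level z"
    if "z \<in> crossing_domain lam" for z
    unfolding level_def by (rule Collect_cong) (metis crossing_code that)
  have comp: "components (level z) = {level z}" if "z \<in> crossing_domain lam" for z
  proof -
    have "z \<in> level z"
      using that by (simp add: level_def)
    moreover have "connected (level z)"
      unfolding level_def by (rule convex_connected[OF convex_crossing_level_set])
    ultimately show ?thesis
      unfolding components_eq_sing_iff by blast
  qed
  have "atoms lam Reflect_First (crossing_time lam) (crossing_domain lam)
      = (\<Union>z\<in>crossing_domain lam. {level z})"
    unfolding atoms_def by (rule SUP_cong) (simp_all only: code comp)
  then show ?thesis
    by (simp only: UNION_singleton_eq_range level_def)
qed

lemma crossing_pw_isometric_involution: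
  assumes "negligible (wedge lam - crossing_domain lam)"
  shows "pw_isometric_involution lam (wedge lam) (crossing_domain lam) Reflect_First (crossing_time lam)"
  unfolding pw_isometric_involution_def transit_map_crossing atoms_crossing
proof (intro conjI ballI)
  fix A assume "A \<in> (\<lambda>z. {w \<in> crossing_domain lam. crossing_time lam w = crossing_time lam z}) ` crossing_domain lam"
  then obtain n where A: "A = {w \<in> crossing_domain lam. crossing_time lam w = n}" by auto
  have "(F lam ^^ crossing_time lam w) (G w) = (rot lam ^^ n) (G w)" if "w \<in> A" for w
    using that before_crossing_time[of w] A by (subst funpow_rot_eq_F) auto
  then show "\<exists>T. Q_isometry lam T \<and> (\<forall>z\<in>A. (F lam ^^ crossing_time lam z) (G z) = T z)"
    using Q_isometry_funpow_rot_G[of lam n] by (intro exI[of _ "\<lambda>w. (rot lam ^^ n) (G w)"]) simp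
next
  show "crossing_domain lam \<subseteq> wedge lam"
    by (auto simp: crossing_domain_def)
qed (simp_all add: assms crossing_involution)

text \<open>
  The involution maps each level set of the transit time into itself, hence onto itself, and by
  \<open>atoms_crossing\<close> these level sets are the atoms.
\<close>

lemma crossing_irregular_part:
  "irregular_part lam Reflect_First (crossing_time lam) (crossing_domain lam) = {}"
proof -
  have "transit_map lam Reflect_First (crossing_time lam) ` A = A"
    if "A \<in> atoms lam Reflect_First (crossing_time lam) (crossing_domain lam)" for A
  proof -
    obtain n where A: "A = {w \<in> crossing_domain lam. crossing_time lam w = n}"
      using \<open>A \<in> _\<close> unfolding atoms_crossing by blast
    have inv: "(F lam ^^ crossing_time lam w) (G w) \<in> A" if "w \<in> A" for w
      using crossing_involution(1,2)[of w] that unfolding A by blast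
    have "w = (F lam ^^ crossing_time lam u) (G u)"
      if "w \<in> A" "u = (F lam ^^ crossing_time lam w) (G w)" for w u
      using crossing_involution(2,3)[of w] that unfolding A by force
    then show ?thesis
      unfolding transit_map_crossing using inv by blast
  qed
  then show ?thesis
    by (rule irregular_part_empty)
qed

lemma atoms_wedge: "atoms lam Reflect_Last (\<lambda>_. 1) (wedge lam) = {wedge lam}"
proof -
  have "(0, 0) \<in> wedge lam"
    by (auto simp: wedge_def Omega_def)
  moreover have "{w \<in> wedge lam. (1::nat) = 1 \<and>
      transit_code lam Reflect_Last (\<lambda>_. 1) w = transit_code lam Reflect_Last (\<lambda>_. 1) z} = wedge lam"
    if "z \<in> wedge lam" for z
    using that by (auto simp: transit_code_def segment_start_def F_on_wedge(1))
  moreover from calculation have "components (wedge lam) = {wedge lam}"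
    using convex_connected[OF convex_wedge] by (auto simp: components_eq_sing_iff)
  ultimately show ?thesis
    by (auto simp: atoms_def)
qed

lemma flip_pw_isometric_involution:
  "pw_isometric_involution lam (wedge lam) (wedge lam) Reflect_Last (\<lambda>_. 1)"
  unfolding pw_isometric_involution_def atoms_wedge transit_map_flip
proof (intro conjI ballI)
  fix A assume "A \<in> {wedge lam}"
  moreover have "Q_isometry lam (\<lambda>z. (fst z, lam * fst z - snd z))"
    by (simp add: Q_isometry_def Q_def field_simps)
  ultimately show "\<exists>T. Q_isometry lam T \<and> (\<forall>z\<in>A. G (F lam z) = T z)"
    using G_F_on_wedge by blast
qed (auto simp: G_F_wedge G_F_involution wedge_in_Omega)

lemma flip_irregular_part: "irregular_part lam Reflect_Last (\<lambda>_. 1) (wedge lam) = {}"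
proof -
  have "(\<lambda>z. G (F lam z)) ` wedge lam = wedge lam"
  proof (intro equalityI subsetI)
    fix z assume "z \<in> wedge lam"
    then show "z \<in> (\<lambda>z. G (F lam z)) ` wedge lam"
      using G_F_wedge[of z] G_F_involution[of z lam] wedge_in_Omega[of z lam]
      by (metis imageI)
  qed (use G_F_wedge in blast)
  then show ?thesis
    by (intro irregular_part_empty) (simp add: atoms_wedge transit_map_flip del: One_nat_def)
qed

text \<open>
  The passage of the flipped point starts at \<open>F z\<close>, so it is the orbit of \<open>z\<close> with the first step
  removed. This is why the return time is one more than the transit time.
\<close>

lemma returns_iff_flip:
  assumes "z \<in> wedge lam"
  shows "returns lam (wedge lam) z \<longleftrightarrow> G (F lam z) \<in> crossing_domain lam"
proof
  assume "returns lam (wedge lam) z"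
  then obtain n where "n > 0" "(F lam ^^ n) z \<in> wedge lam"
    by (auto simp: returns_def)
  then obtain m where "(F lam ^^ m) (F lam z) \<in> wedge lam"
    by (cases n) (auto simp: funpow_swap1)
  then show "G (F lam z) \<in> crossing_domain lam"
    using assms by (auto simp: crossing_domain_def G_F_wedge)
next
  assume "G (F lam z) \<in> crossing_domain lam"
  then obtain m where "(F lam ^^ m) (F lam z) \<in> wedge lam"
    by (auto simp: crossing_domain_def)
  then show "returns lam (wedge lam) z"
    unfolding returns_def by (intro exI[of _ "Suc m"]) (simp add: funpow_swap1)
qed

lemma first_return_eq:
  assumes "z \<in> wedge lam" "returns lam (wedge lam) z"
  shows "first_return lam (wedge lam) z
    = (F lam ^^ crossing_time lam (G (F lam z))) (G (G (F lam z)))"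
proof -
  let ?P = "\<lambda>n. n > 0 \<and> (F lam ^^ n) z \<in> wedge lam"
  obtain n where n: "?P n"
    using assms by (auto simp: returns_def)
  have shift: "(F lam ^^ Suc m) z = (F lam ^^ m) (G (G (F lam z)))" for m
    by (simp only: funpow_Suc_right o_apply G_G)
  have "Least ?P = Suc (LEAST m. ?P (Suc m))"
    using n by (rule Least_Suc) simp
  also have "(LEAST m. ?P (Suc m)) = crossing_time lam (G (F lam z))"
    unfolding crossing_time_def shift by simp
  finally show ?thesis
    unfolding first_return_def using shift by simp
qed

end

section \<open>Recurrence to the wedge\<close>

lemma Q_funpow_rot:
  "Q lam ((rot lam ^^ n) u - (rot lam ^^ n) v) ((rot lam ^^ n) u - (rot lam ^^ n) v) = Q lam (u - v) (u - v)"
proof (induction n)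
  case (Suc n)
  have "Q lam (rot lam u - rot lam v) (rot lam u - rot lam v) = Q lam (u - v) (u - v)" for u v
    by (simp add: Q_def rot_def field_simps)
  with Suc show ?case by simp
qed simp

lemma bounded_Omega: "bounded Omega"
proof (rule bounded_subset)
  show "Omega \<subseteq> {0..1} \<times> {0..1}"
    by (auto simp: Omega_def)
qed (auto intro: bounded_Times)

context small_parameter
begin

text \<open>
  \<open>Q\<close> is comparable with the Euclidean norm, uniformly in \<open>\<lambda>\<close>; recurrence can thus be argued with the
  Euclidean distance although the rotation is an isometry only for \<open>Q\<close>.
\<close>

lemma Q_bounds:
  "(norm u)\<^sup>2 / 2 \<le> Q lam u u" "Q lam u u \<le> 2 * (norm u)\<^sup>2"
proof -
  define x y where "x = fst u" and "y = snd u"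
  have n: "(norm u)\<^sup>2 = x\<^sup>2 + y\<^sup>2"
    by (simp add: x_def y_def norm_prod_def)
  have q: "Q lam u u = x\<^sup>2 + y\<^sup>2 - lam * (x * y)"
    by (simp add: Q_def x_def y_def power2_eq_square algebra_simps)
  have "\<bar>x * y\<bar> \<le> (x\<^sup>2 + y\<^sup>2) / 2"
    using sum_squares_bound[of x y] sum_squares_bound[of x "- y"] by (simp add: abs_le_iff)
  moreover have "\<bar>lam * (x * y)\<bar> \<le> \<bar>x * y\<bar>"
    using lam by (simp add: abs_mult mult_left_le_one_le)
  ultimately have "lam * (x * y) \<le> (x\<^sup>2 + y\<^sup>2) / 2" "- (lam * (x * y)) \<le> (x\<^sup>2 + y\<^sup>2) / 2"
    by (simp_all add: abs_le_iff)
  moreover have "0 \<le> x\<^sup>2 + y\<^sup>2"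
    by simp
  ultimately show "(norm u)\<^sup>2 / 2 \<le> Q lam u u" "Q lam u u \<le> 2 * (norm u)\<^sup>2"
    unfolding n q by (simp_all add: field_simps)
qed

text \<open>
  Let \<open>p\<close> be the preimage of \<open>G w\<close> under the rotation; it lies strictly above the line \<open>y = 1\<close>. If the
  orbit never met the wedge, all later points of the rotation orbit of \<open>p\<close> would lie in \<open>\<Omega>\<close>, so
  they would stay at a positive distance from \<open>p\<close>. As the rotation is an isometry, all points of
  the orbit would then be uniformly separated from each other, which is impossible in a bounded set.
\<close>

lemma crossing_domainI:
  assumes w: "w \<in> wedge lam" and below: "snd w < lam * fst w"
  shows "w \<in> crossing_domain lam"
proof (rule ccontr)
  assume "w \<notin> crossing_domain lam"
  then have off: "(F lam ^^ n) (G w) \<in> Omega - wedge lam" for n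
    using w by (auto simp: crossing_domain_def wedge_in_Omega funpow_F_in_Omega)
  \<comment> \<open>\<open>p\<close> is the rotation preimage of \<open>G w\<close>, and \<open>2 e\<close> is its height above the line \<open>y = 1\<close>.\<close>
  define p where "p = (fst w, lam * fst w - snd w + 1)"
  define e where "e = (lam * fst w - snd w) / 2"
  have "e > 0"
    using below by (simp add: e_def)
  have "rot lam p = G w"
    by (simp add: rot_def G_def p_def)
  then have "(rot lam ^^ Suc n) p = (F lam ^^ n) (G w)" for n
    using funpow_rot_eq_F[of n "G w"] off by (simp only: funpow_Suc_right o_apply)
  then have orbit: "(rot lam ^^ Suc n) p \<in> Omega" for n
    using off by simp
  have sep: "e \<le> dist ((rot lam ^^ m) p) ((rot lam ^^ n) p)" if "m < n" for m n
  proof -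
    obtain k where n: "n = m + Suc k"
      using less_iff_Suc_add \<open>m < n\<close> by auto
    define v where "v = p - (rot lam ^^ Suc k) p"
    have "snd ((rot lam ^^ Suc k) p) < 1"
      using orbit[of k] unfolding Omega_def by (simp add: mem_Times_iff)
    then have "2 * e \<le> snd v"
      by (simp add: v_def p_def e_def)
    also have "snd v \<le> norm v"
      using norm_snd_le[of "snd v" "fst v"] by simp
    finally have "(2 * e)\<^sup>2 / 2 \<le> (norm v)\<^sup>2 / 2"
      using power_mono[of "2 * e" "norm v" 2] \<open>e > 0\<close> by simp
    also have "\<dots> \<le> Q lam v v"
      by (rule Q_bounds)
    also have "\<dots> = Q lam ((rot lam ^^ m) p - (rot lam ^^ n) p) ((rot lam ^^ m) p - (rot lam ^^ n) p)"
      unfolding n v_def funpow_add o_apply Q_funpow_rot ..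
    also have "\<dots> \<le> 2 * (dist ((rot lam ^^ m) p) ((rot lam ^^ n) p))\<^sup>2"
      unfolding dist_norm by (rule Q_bounds)
    finally have "e\<^sup>2 \<le> (dist ((rot lam ^^ m) p) ((rot lam ^^ n) p))\<^sup>2"
      by (simp add: power_mult_distrib)
    then show ?thesis
      by (rule power2_le_imp_le) simp
  qed
  have "bounded (range (\<lambda>n. (rot lam ^^ Suc n) p))"
    using orbit by (intro bounded_subset[OF bounded_Omega]) auto
  then obtain l r where r: "strict_mono (r :: nat \<Rightarrow> nat)"
    and lim: "((\<lambda>n. (rot lam ^^ Suc n) p) \<circ> r) \<longlonglongrightarrow> l"
    using bounded_imp_convergent_subsequence by blast
  then have "Cauchy ((\<lambda>n. (rot lam ^^ Suc n) p) \<circ> r)"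
    by (intro LIMSEQ_imp_Cauchy)
  then obtain N where "dist ((rot lam ^^ Suc (r N)) p) ((rot lam ^^ Suc (r (Suc N))) p) < e"
    using \<open>e > 0\<close> unfolding Cauchy_def o_def by (meson le_refl le_SucI)
  moreover have "Suc (r N) < Suc (r (Suc N))"
    using r by (simp add: strict_mono_Suc_iff)
  ultimately show False
    using sep[of "Suc (r N)" "Suc (r (Suc N))"] by linarith
qed

lemma negligible_not_crossing: "negligible (wedge lam - crossing_domain lam)"
proof (rule negligible_subset)
  show "negligible {z :: point. (- lam, 1) \<bullet> z = 0}"
    by (rule negligible_hyperplane) (simp add: zero_prod_def)
  show "wedge lam - crossing_domain lam \<subseteq> {z. (- lam, 1) \<bullet> z = 0}"
  proof
    fix w assume w: "w \<in> wedge lam - crossing_domain lam"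
    then have "\<not> snd w < lam * fst w"
      using crossing_domainI by blast
    moreover have "snd w \<le> lam * fst w"
      using w by (simp add: wedge_def)
    ultimately show "w \<in> {z. (- lam, 1) \<bullet> z = 0}"
      by (simp add: inner_prod_def)
  qed
qed

text \<open>
  The flip maps the lower edge of the wedge onto the line \<open>y = \<lambda>x\<close>, the edge excluded in
  \<open>crossing_domainI\<close>.
\<close>

lemma negligible_not_returning: "negligible {z \<in> wedge lam. \<not> returns lam (wedge lam) z}"
proof (rule negligible_subset)
  show "negligible {z :: point. (0, 1) \<bullet> z = 0}"
    by (rule negligible_hyperplane) (simp add: zero_prod_def)
  show "{z \<in> wedge lam. \<not> returns lam (wedge lam) z} \<subseteq> {z. (0, 1) \<bullet> z = 0}"
  proof
    fix z assume "z \<in> {z \<in> wedge lam. \<not> returns lam (wedge lam) z}"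
    then have z: "z \<in> wedge lam" "G (F lam z) \<notin> crossing_domain lam"
      using returns_iff_flip[of z] by simp_all
    then have "\<not> snd (G (F lam z)) < lam * fst (G (F lam z))"
      using crossing_domainI G_F_wedge by blast
    then have "snd z \<le> 0"
      by (simp add: G_F_on_wedge[OF z(1)])
    moreover have "snd z \<ge> 0"
      using z(1) by (auto simp: wedge_def Omega_def)
    ultimately show "z \<in> {z. (0, 1) \<bullet> z = 0}"
      by (simp add: inner_prod_def)
  qed
qed

end

section \<open>Orbits that avoid the wedge\<close>

lemma F_borel_measurable: "F lam \<in> borel_measurable borel"
proof -
  have "F lam = (\<lambda>z. (lam * fst z - snd z - real_of_int \<lfloor>lam * fst z - snd z\<rfloor>, fst z))"
    by (auto simp: F_def iota_def)
  also have "\<dots> \<in> borel_measurable borel"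
    unfolding borel_prod[symmetric] by measurable
  finally show ?thesis .
qed

lemma G_borel_measurable: "G \<in> borel_measurable borel"
  unfolding G_def[abs_def] borel_prod[symmetric] by measurable

lemma Omega_borel: "Omega \<in> sets borel"
  unfolding Omega_def borel_prod[symmetric] by measurable

lemma wedge_borel: "wedge lam \<in> sets borel"
proof -
  have "wedge lam = Omega \<inter> {z. (- lam, 1) \<bullet> z \<le> 0}"
    by (auto simp: wedge_def inner_prod_def)
  then show ?thesis
    using Omega_borel closed_halfspace_le[of "(- lam, 1)" 0] by auto
qed

text \<open>
  Rewriting the past through the reflection replaces preimages of \<open>z\<close> by Borel functions of \<open>z\<close>.
\<close>

lemma F_orbit_avoids_wedge_iff:
  assumes "z \<in> Omega"
  shows "F_orbit lam z \<inter> wedge lam = {} \<longleftrightarrow>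
    (\<forall>n. (F lam ^^ n) z \<notin> wedge lam \<and> G ((F lam ^^ n) (G z)) \<notin> wedge lam)"
proof -
  have past: "(F lam ^^ n) w = z \<longleftrightarrow> w = G ((F lam ^^ n) (G z))" if "w \<in> Omega" for w n
    by (rule funpow_F_eq_iff[OF that assms])
  have orbit: "w \<in> F_orbit lam z \<longleftrightarrow> (\<exists>n. (F lam ^^ n) z = w \<or> G ((F lam ^^ n) (G z)) = w)"
    if "w \<in> wedge lam" for w
    using past[OF wedge_in_Omega[OF that]] wedge_in_Omega[OF that]
    by (simp add: F_orbit_def eq_commute[of w])
  show ?thesis
  proof
    assume none: "F_orbit lam z \<inter> wedge lam = {}"
    show "\<forall>n. (F lam ^^ n) z \<notin> wedge lam \<and> G ((F lam ^^ n) (G z)) \<notin> wedge lam"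
    proof (intro allI conjI notI)
      fix n
      show False if "(F lam ^^ n) z \<in> wedge lam"
        using orbit[OF that] none that by blast
      show False if "G ((F lam ^^ n) (G z)) \<in> wedge lam"
        using orbit[OF that] none that by blast
    qed
  next
    assume "\<forall>n. (F lam ^^ n) z \<notin> wedge lam \<and> G ((F lam ^^ n) (G z)) \<notin> wedge lam"
    then show "F_orbit lam z \<inter> wedge lam = {}"
      using orbit by blast
  qed
qed

lemma avoiding_set_borel: "{z \<in> Omega. F_orbit lam z \<inter> wedge lam = {}} \<in> sets borel"
proof -
  have iter: "(F lam ^^ n) \<in> borel_measurable borel" for n
  proof (induction n)
    case (Suc n)
    show ?case
      unfolding funpow.simps by (rule measurable_comp[OF Suc F_borel_measurable])
  qed (simp add: id_def)
  have "(\<lambda>z. G ((F lam ^^ n) (G z))) \<in> borel_measurable borel" for n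
    using measurable_comp[OF measurable_comp[OF G_borel_measurable iter] G_borel_measurable]
    by (simp add: comp_def)
  from measurable_sets[OF this wedge_borel] measurable_sets[OF iter wedge_borel]
  have "(\<lambda>z. G ((F lam ^^ n) (G z))) -` wedge lam \<in> sets borel"
    "(F lam ^^ n) -` wedge lam \<in> sets borel" for n
    by simp_all
  then have "Omega - (\<Union>n. (F lam ^^ n) -` wedge lam \<union> (\<lambda>z. G ((F lam ^^ n) (G z))) -` wedge lam)
     \<in> sets borel"
    using Omega_borel by (intro sets.Diff sets.countable_UN sets.Un) auto
  also have "Omega - (\<Union>n. (F lam ^^ n) -` wedge lam \<union> (\<lambda>z. G ((F lam ^^ n) (G z))) -` wedge lam)
     = {z \<in> Omega. F_orbit lam z \<inter> wedge lam = {}}"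
  proof (rule set_eqI)
    fix z
    show "z \<in> Omega - (\<Union>n. (F lam ^^ n) -` wedge lam \<union> (\<lambda>z. G ((F lam ^^ n) (G z))) -` wedge lam)
      \<longleftrightarrow> z \<in> {z \<in> Omega. F_orbit lam z \<inter> wedge lam = {}}"
      by (cases "z \<in> Omega") (simp_all add: F_orbit_avoids_wedge_iff)
  qed
  finally show ?thesis .
qed

text \<open>
  The normalisation makes \<open>s > 0\<close> the horizontal and vertical half-width of the ellipse.
\<close>

definition ellipse_disc :: "real \<Rightarrow> real \<Rightarrow> point set" where
  "ellipse_disc lam s = {z. Q lam (z - centre lam) (z - centre lam) \<le> (1 - lam\<^sup>2 / 4) * s\<^sup>2}"

lemma main_island_eq_ellipse_disc: "main_island lam = ellipse_disc lam ((1 - lam) / (2 - lam))"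
  by (simp add: main_island_def ellipse_disc_def)

context small_parameter
begin

lemma unit_Q_disc_subset: "{u. Q lam u u \<le> 1 - lam\<^sup>2 / 4} \<subseteq> cbox (-1, -1) (1, 1)"
proof
  fix u assume u: "u \<in> {u. Q lam u u \<le> 1 - lam\<^sup>2 / 4}"
  define x y where "x = fst u" and "y = snd u"
  have pos: "1 - lam\<^sup>2 / 4 > 0"
    using lam power_strict_mono[of lam 1 2] by simp
  have "(1 - lam\<^sup>2 / 4) * x\<^sup>2 \<le> (y - lam / 2 * x)\<^sup>2 + (1 - lam\<^sup>2 / 4) * x\<^sup>2"
    by simp
  also have "\<dots> = Q lam u u"
    by (simp add: Q_def x_def y_def power2_eq_square field_simps)
  finally have "(1 - lam\<^sup>2 / 4) * x\<^sup>2 \<le> Q lam u u" .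
  have "(1 - lam\<^sup>2 / 4) * y\<^sup>2 \<le> (x - lam / 2 * y)\<^sup>2 + (1 - lam\<^sup>2 / 4) * y\<^sup>2"
    by simp
  also have "\<dots> = Q lam u u"
    by (simp add: Q_def x_def y_def power2_eq_square field_simps)
  finally have "(1 - lam\<^sup>2 / 4) * y\<^sup>2 \<le> Q lam u u" .
  with \<open>(1 - lam\<^sup>2 / 4) * x\<^sup>2 \<le> Q lam u u\<close> have "(1 - lam\<^sup>2 / 4) * x\<^sup>2 \<le> (1 - lam\<^sup>2 / 4) * 1" "(1 - lam\<^sup>2 / 4) * y\<^sup>2 \<le> (1 - lam\<^sup>2 / 4) * 1"
    using u by simp_all
  then have "x\<^sup>2 \<le> 1" "y\<^sup>2 \<le> 1"
    using pos by (simp_all only: mult_le_cancel_left_pos)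
  then have "\<bar>x\<bar> \<le> 1" "\<bar>y\<bar> \<le> 1"
    by (simp_all add: abs_square_le_1)
  then show "u \<in> cbox (-1, -1) (1, 1)"
    by (auto simp: x_def y_def cbox_Pair_eq mem_Times_iff abs_le_iff)
qed

lemma compact_unit_Q_disc: "compact {u. Q lam u u \<le> 1 - lam\<^sup>2 / 4}"
proof -
  have "closed {u. Q lam u u \<le> 1 - lam\<^sup>2 / 4}"
    unfolding Q_def by (intro closed_Collect_le continuous_intros)
  moreover have "bounded {u. Q lam u u \<le> 1 - lam\<^sup>2 / 4}"
    using unit_Q_disc_subset bounded_cbox bounded_subset by blast
  ultimately show ?thesis
    by (simp add: compact_eq_bounded_closed)
qed

lemma measure_unit_Q_disc: "measure lebesgue {u. Q lam u u \<le> 1 - lam\<^sup>2 / 4} \<le> 4"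
proof -
  have "measure lebesgue {u. Q lam u u \<le> 1 - lam\<^sup>2 / 4}
      \<le> measure lebesgue (cbox (-1, -1) (1, 1 :: real) :: point set)"
    using unit_Q_disc_subset lmeasurable_compact[OF compact_unit_Q_disc] by (intro measure_mono_fmeasurable) auto
  also have "\<dots> = 4"
    by (simp add: content_Pair)
  finally show ?thesis .
qed

lemma ellipse_disc_eq_image:
  assumes "s > 0"
  shows "ellipse_disc lam s = (\<lambda>u. s *\<^sub>R u + centre lam) ` {u. Q lam u u \<le> 1 - lam\<^sup>2 / 4}"
proof -
  have scale: "Q lam (s *\<^sub>R u) (s *\<^sub>R u) = s\<^sup>2 * Q lam u u" for u
    by (simp add: Q_def power2_eq_square field_simps)
  have mem: "s *\<^sub>R u + centre lam \<in> ellipse_disc lam s \<longleftrightarrow> Q lam u u \<le> 1 - lam\<^sup>2 / 4" for u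
    using assms by (simp add: ellipse_disc_def scale mult.commute)
  show ?thesis
  proof (intro equalityI subsetI)
    fix z assume z: "z \<in> ellipse_disc lam s"
    have "z = s *\<^sub>R ((1 / s) *\<^sub>R (z - centre lam)) + centre lam"
      using assms by simp
    then show "z \<in> (\<lambda>u. s *\<^sub>R u + centre lam) ` {u. Q lam u u \<le> 1 - lam\<^sup>2 / 4}"
      using mem z by (metis (mono_tags, lifting) imageI mem_Collect_eq)
  qed (use mem in auto)
qed

lemma ellipse_disc_area:
  assumes "s > 0"
  shows "ellipse_disc lam s \<in> lmeasurable"
    "measure lebesgue (ellipse_disc lam s) = s\<^sup>2 * measure lebesgue {u. Q lam u u \<le> 1 - lam\<^sup>2 / 4}"
proof -
  have "compact (ellipse_disc lam s)"
    unfolding ellipse_disc_eq_image[OF assms]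
    by (intro compact_continuous_image compact_unit_Q_disc continuous_intros)
  then show "ellipse_disc lam s \<in> lmeasurable"
    by (rule lmeasurable_compact)
  show "measure lebesgue (ellipse_disc lam s) = s\<^sup>2 * measure lebesgue {u. Q lam u u \<le> 1 - lam\<^sup>2 / 4}"
    unfolding ellipse_disc_eq_image[OF assms]
    using measure_lebesgue_affine[of s "centre lam" "{u. Q lam u u \<le> 1 - lam\<^sup>2 / 4}"]
    by (simp add: power2_eq_square)
qed

text \<open>
  In suitable coordinates the orbit is \<open>x\<^sub>j = c + A cos (\<phi> + j \<theta>)\<close> with \<open>2 cos \<theta> = \<lambda>\<close>, and the ellipse
  through \<open>z\<close> has half-width \<open>A\<close>. The times \<open>j = 4 k\<close> turn the phase backwards in steps of
  \<open>2 h = 2 \<pi> - 4 \<theta>\<close>, so one of them brings it within \<open>h\<close> of \<open>0\<close>. There the bound \<open>x\<^sub>j < 1\<close> gives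
  \<open>A cos h < 1 - c\<close>, where \<open>1 - c\<close> is the half-width of the main island.
\<close>

lemma bounded_rotation_orbit_in_ellipse:
  assumes "\<And>j. fst ((rot lam ^^ j) z) < 1"
  shows "z \<in> ellipse_disc lam ((1 - lam) / (2 - lam) / (1 - lam\<^sup>2 / 2))"
proof -
  define r c where "r = (1 - lam) / (2 - lam)" and "c = 1 / (2 - lam)"
  have c: "1 - c = r" "lam * c - c + 1 = c"
  proof -
    have "c * (2 - lam) = 1"
      using lam by (simp add: c_def)
    then show "lam * c - c + 1 = c"
      by (simp add: algebra_simps)
    show "1 - c = r"
      using lam by (simp add: r_def c_def divide_simps)
  qed
  define \<theta> where "\<theta> = arccos (lam / 2)"
  have cos_\<theta>: "cos \<theta> = lam / 2"
    using lam by (simp add: \<theta>_def)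
  have \<theta>: "0 < \<theta>" "\<theta> < pi / 2"
    using lam arccos_lt_bounded[of "lam / 2"] arccos_less_arccos[of 0 "lam / 2"]
    by (auto simp: \<theta>_def arccos_0)
  then have sin_pos: "sin \<theta> > 0"
    by (intro sin_gt_zero) auto
  \<comment> \<open>The imaginary part is chosen so that the polar angle of \<open>w\<close> is the phase of the orbit: the real
    part is \<open>x\<^sub>0 - c\<close>, and the second coordinate of \<open>z\<close> becomes \<open>x\<^sub>-\<^sub>1 = c + A cos (\<phi> - \<theta>)\<close>.\<close>
  define w where "w = Complex (fst z - c) ((snd z - c - (fst z - c) * cos \<theta>) / sin \<theta>)"
  define A \<phi> where "A = cmod w" and "\<phi> = Arg2pi w"
  have w: "w = of_real A * cis \<phi>"
    unfolding A_def \<phi>_def using Arg2pi_eq[of w] by (simp add: cis_conv_exp)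
  then have x: "fst z - c = A * cos \<phi>" and y: "snd z - c = A * cos (\<phi> - \<theta>)"
  proof -
    have "Re w = A * cos \<phi>" "Im w = A * sin \<phi>"
      using w by (simp_all add: complex_eq_iff)
    then have *: "fst z - c = A * cos \<phi>"
      "(snd z - c - (fst z - c) * cos \<theta>) / sin \<theta> = A * sin \<phi>"
      by (simp_all add: w_def)
    then show "fst z - c = A * cos \<phi>" "snd z - c = A * cos (\<phi> - \<theta>)"
      using sin_pos by (auto simp: cos_diff field_simps)
  qed
  have orbit: "(rot lam ^^ j) z = (c + A * cos (\<phi> + j * \<theta>), c + A * cos (\<phi> + j * \<theta> - \<theta>))" for j :: nat
  proof (induction j)
    case 0
    then show ?case
      using x y by (simp add: prod_eq_iff)
  next
    case (Suc j)
    define a where "a = \<phi> + j * \<theta>"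
    have "cos (a + \<theta>) = lam * cos a - cos (a - \<theta>)"
      using cos_\<theta> by (simp add: cos_add cos_diff)
    then have "A * cos (a + \<theta>) = lam * (A * cos a) - A * cos (a - \<theta>)"
      by (simp only: right_diff_distrib mult.left_commute)
    then have "lam * (c + A * cos a) - (c + A * cos (a - \<theta>)) + 1 = c + A * cos (a + \<theta>)"
      using c(2) by (simp add: algebra_simps)
    then show ?case
      using Suc by (simp add: rot_def a_def algebra_simps)
  qed
  define h where "h = pi - 2 * \<theta>"
  have h: "0 < h" "h < pi"
    using \<theta> by (auto simp: h_def)
  have cos_h: "cos h = 1 - lam\<^sup>2 / 2"
    by (simp add: h_def cos_double_cos cos_\<theta> power_divide)
  \<comment> \<open>\<open>k\<close> steps of size \<open>2 h\<close> back from \<open>\<phi> \<ge> 0\<close> end nearest to \<open>0\<close>.\<close>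
  define k where "k = nat \<lfloor>\<phi> / (2 * h) + 1 / 2\<rfloor>"
  have "\<phi> \<ge> 0"
    by (simp add: \<phi>_def Arg2pi_ge_0)
  then have "real k = of_int \<lfloor>\<phi> / (2 * h) + 1 / 2\<rfloor>"
    using h by (simp add: k_def)
  then have "real k \<le> \<phi> / (2 * h) + 1 / 2" "\<phi> / (2 * h) + 1 / 2 < real k + 1"
    by linarith+
  then have near: "\<bar>\<phi> - k * (2 * h)\<bar> \<le> h"
    using h by (auto simp: field_simps abs_le_iff)
  have "cos (\<phi> + (4 * k) * \<theta>) = cos (\<phi> - k * (2 * h) + 2 * pi * k)"
    by (simp add: h_def algebra_simps)
  also have "\<dots> = cos (\<phi> - k * (2 * h))"
    using cos.plus_of_nat[of "\<phi> - k * (2 * h)" k] by (simp add: mult.commute)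
  also have "\<dots> \<ge> cos h"
    using near h cos_monotone_0_pi_le[of "\<bar>\<phi> - k * (2 * h)\<bar>" h] by simp
  finally have "A * cos h \<le> A * cos (\<phi> + (4 * k) * \<theta>)"
    by (intro mult_left_mono) (auto simp: A_def)
  also have "\<dots> < r"
    using assms[of "4 * k"] orbit[of "4 * k"] c(1) by simp
  finally have "A * (1 - lam\<^sup>2 / 2) < r"
    by (simp add: cos_h)
  moreover have "0 < 1 - lam\<^sup>2 / 2"
    using lam power_strict_mono[of lam 1 2] by simp
  ultimately have "A \<le> r / (1 - lam\<^sup>2 / 2)"
    by (simp add: pos_le_divide_eq)
  then have "A\<^sup>2 \<le> (r / (1 - lam\<^sup>2 / 2))\<^sup>2"
    by (intro power_mono) (auto simp: A_def)
  moreover have "Q lam (z - centre lam) (z - centre lam) = (1 - lam\<^sup>2 / 4) * A\<^sup>2"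
  proof -
    have s: "(sin \<theta>)\<^sup>2 = 1 - lam\<^sup>2 / 4"
      by (simp add: sin_squared_eq cos_\<theta> power_divide)
    define X Y where "X = A * cos \<phi>" and "Y = A * sin \<phi>"
    have X: "fst z - c = X" and "snd z - c = lam / 2 * X + Y * sin \<theta>"
      using x y cos_\<theta> by (simp_all add: X_def Y_def cos_diff algebra_simps)
    then have "Q lam (z - centre lam) (z - centre lam)
        = X\<^sup>2 + (lam / 2 * X + Y * sin \<theta>)\<^sup>2 - lam * X * (lam / 2 * X + Y * sin \<theta>)"
      unfolding Q_def centre_def c_def[symmetric] by (simp add: power2_eq_square algebra_simps)
    also have "\<dots> = (1 - lam\<^sup>2 / 4) * X\<^sup>2 + Y\<^sup>2 * (sin \<theta>)\<^sup>2"
      by (simp add: power2_eq_square algebra_simps)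
    also have "\<dots> = (1 - lam\<^sup>2 / 4) * (X\<^sup>2 + Y\<^sup>2)"
      unfolding s by (simp add: algebra_simps)
    also have "X\<^sup>2 + Y\<^sup>2 = A\<^sup>2"
      unfolding X_def Y_def power_mult_distrib distrib_left[symmetric] by simp
    finally show ?thesis .
  qed
  moreover have "1 - lam\<^sup>2 / 4 \<ge> 0"
    using lam power_strict_mono[of lam 1 2] by simp
  ultimately show ?thesis
    unfolding ellipse_disc_def r_def by (simp add: mult_left_mono)
qed

text \<open>
  The set is contained in the annulus between the main island and a concentric ellipse larger by the
  factor \<open>1 / (1 - \<lambda>^2/2)\<close>; areas of these ellipses scale with the square of the half-width. The
  measurability of the set itself is part of the claim.
\<close>

lemma avoiding_set_area:
  "area_le {z \<in> Omega - main_island lam. F_orbit lam z \<inter> wedge lam = {}} (4 * lam\<^sup>2)"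
proof -
  define r s where "r = (1 - lam) / (2 - lam)" and "s = r / (1 - lam\<^sup>2 / 2)"
  define N where "N = {z \<in> Omega - main_island lam. F_orbit lam z \<inter> wedge lam = {}}"
  define m where "m = measure lebesgue {u. Q lam u u \<le> 1 - lam\<^sup>2 / 4}"
  have sq: "lam\<^sup>2 < 1"
    using lam power_strict_mono[of lam 1 2] by simp
  have r: "0 < r" "r \<le> 1 / 2"
    using lam by (auto simp: r_def field_simps)
  have "r \<le> s"
    using r sq by (simp add: s_def pos_le_divide_eq mult_left_le)
  have island: "main_island lam = ellipse_disc lam r"
    by (simp add: main_island_eq_ellipse_disc r_def)
  have "N \<subseteq> ellipse_disc lam s - ellipse_disc lam r"
  proof
    fix z assume z: "z \<in> N"
    have off: "(F lam ^^ j) z \<in> Omega - wedge lam" for j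
      using z F_orbit_avoids_wedge_iff[of z] funpow_F_in_Omega[of z j lam] by (auto simp: N_def)
    have "(rot lam ^^ j) z \<in> Omega" for j
      using funpow_rot_eq_F[of j z] off by simp
    then have "fst ((rot lam ^^ j) z) < 1" for j
      by (simp add: Omega_def mem_Times_iff)
    then show "z \<in> ellipse_disc lam s - ellipse_disc lam r"
      using bounded_rotation_orbit_in_ellipse[of z] z island by (simp add: N_def s_def r_def)
  qed
  moreover have disc: "ellipse_disc lam s \<in> lmeasurable" "ellipse_disc lam r \<in> lmeasurable"
    using ellipse_disc_area(1) r \<open>r \<le> s\<close> by auto
  moreover have N: "N \<in> sets lebesgue"
  proof -
    have "N = {z \<in> Omega. F_orbit lam z \<inter> wedge lam = {}} - ellipse_disc lam r"
      by (auto simp: N_def island)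
    then show ?thesis
      using avoiding_set_borel disc(2) by (auto intro!: sets.Diff simp: fmeasurableD)
  qed
  ultimately have "N \<in> lmeasurable" "measure lebesgue N \<le> measure lebesgue (ellipse_disc lam s - ellipse_disc lam r)"
    by (auto intro: fmeasurableI2 fmeasurable.Diff measure_mono_fmeasurable)
  moreover have "measure lebesgue (ellipse_disc lam s - ellipse_disc lam r) \<le> 4 * lam\<^sup>2"
  proof -
    have "ellipse_disc lam r \<subseteq> ellipse_disc lam s"
    proof -
      have "(1 - lam\<^sup>2 / 4) * r\<^sup>2 \<le> (1 - lam\<^sup>2 / 4) * s\<^sup>2"
        using sq r \<open>r \<le> s\<close> by (intro mult_left_mono power_mono) auto
      then show ?thesis
        unfolding ellipse_disc_def by (intro Collect_mono impI) (rule order_trans)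
    qed
    then have "measure lebesgue (ellipse_disc lam s - ellipse_disc lam r)
        = measure lebesgue (ellipse_disc lam s) - measure lebesgue (ellipse_disc lam r)"
      using disc by (intro measurable_measure_Diff) (auto simp: fmeasurableD)
    also have "\<dots> = (s\<^sup>2 - r\<^sup>2) * m"
      using ellipse_disc_area(2) r \<open>r \<le> s\<close> by (simp add: m_def left_diff_distrib)
    also have "\<dots> \<le> lam\<^sup>2 * 4"
    proof (intro mult_mono)
      define d where "d = 1 - lam\<^sup>2 / 2"
      have d: "1 / 2 \<le> d" "d \<le> 1"
        using sq by (auto simp: d_def)
      have "s\<^sup>2 - r\<^sup>2 = r\<^sup>2 * (1 - d\<^sup>2) / d\<^sup>2"
        using d by (simp add: s_def d_def[symmetric] power_divide field_simps)
      also have "\<dots> \<le> (1 / 2)\<^sup>2 * lam\<^sup>2 / (1 / 2)\<^sup>2"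
      proof (intro frac_le mult_mono)
        show "1 - d\<^sup>2 \<le> lam\<^sup>2"
        proof -
          have "1 - d\<^sup>2 = lam\<^sup>2 - (lam\<^sup>2 / 2)\<^sup>2"
            by (simp add: d_def power2_eq_square algebra_simps)
          then show ?thesis
            by simp
        qed
        show "0 \<le> 1 - d\<^sup>2"
          using d by (simp add: power_le_one)
        show "(1 / 2)\<^sup>2 \<le> d\<^sup>2" "r\<^sup>2 \<le> (1 / 2)\<^sup>2"
          using d r by (intro power_mono; simp)+
      qed simp_all
      finally show "s\<^sup>2 - r\<^sup>2 \<le> lam\<^sup>2"
        by simp
    qed (use measure_unit_Q_disc in \<open>auto simp: m_def\<close>)
    finally show ?thesis by simp
  qed
  ultimately show ?thesis
    unfolding area_le_def N_def by auto
qed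

end

section \<open>Area of the wedge and the theorem\<close>

context small_parameter
begin

lemma wedge_planar_domain: "planar_domain (wedge lam)"
proof -
  define U :: "point set" where "U = ({0<..<1} \<times> {0<..<1}) \<inter> {z. (- lam, 1) \<bullet> z < 0}"
  have "open U"
    unfolding U_def by (intro open_Int open_Times open_greaterThanLessThan open_halfspace_lt)
  have "U \<subseteq> wedge lam"
    by (auto simp: U_def wedge_def Omega_def inner_prod_def)
  have "(1 / 2, lam / 4) \<in> U"
    using lam by (simp add: U_def inner_prod_def)
  then have "interior (wedge lam) \<noteq> {}"
    using interior_maximal[OF \<open>U \<subseteq> wedge lam\<close> \<open>open U\<close>] by blast
  then have "closure (interior (wedge lam)) = closure (wedge lam)"
    by (rule convex_closure_interior[OF convex_wedge])
  moreover have "wedge lam \<noteq> {}"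
    using \<open>U \<subseteq> wedge lam\<close> \<open>_ \<in> U\<close> by blast
  moreover have "wedge lam \<in> sets lebesgue"
    using wedge_borel by simp
  ultimately show ?thesis
    unfolding planar_domain_def using closure_subset by simp
qed

lemma wedge_area: "area_le (wedge lam) lam"
proof -
  have sub: "wedge lam \<subseteq> cbox (0, 0) (1, lam)"
  proof
    fix z assume z: "z \<in> wedge lam"
    have "lam * fst z \<le> lam * 1"
      using z lam by (intro mult_left_mono) (auto simp: wedge_def Omega_def)
    then show "z \<in> cbox (0, 0) (1, lam)"
      using z by (auto simp: wedge_def Omega_def cbox_Pair_eq mem_Times_iff)
  qed
  then have lm: "wedge lam \<in> lmeasurable"
    using wedge_borel by (intro fmeasurableI2[OF lmeasurable_cbox]) auto
  have "measure lebesgue (wedge lam) \<le> measure lebesgue (cbox (0, 0) (1, lam) :: point set)"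
    using sub lm by (intro measure_mono_fmeasurable) auto
  also have "\<dots> = lam"
    using lam by (simp add: content_Pair)
  finally show ?thesis
    using lm by (simp add: area_le_def)
qed

end

theorem theoremA:
  "\<exists>lam0 K :: real. lam0 > 0 \<and> (\<forall>lam. 0 < lam \<and> lam < lam0 \<longrightarrow>
     (\<exists>\<Lambda>. planar_domain \<Lambda> \<and> \<Lambda> \<subseteq> Omega \<and> area_le \<Lambda> (K * lam) \<and>
        area_le {z \<in> Omega - main_island lam. F_orbit lam z \<inter> \<Lambda> = {}} (K * lam\<^sup>2) \<and>
        (\<exists>D1 p1 t1 D2 p2 t2.
           pw_isometric_involution lam \<Lambda> D1 p1 t1 \<and>
           pw_isometric_involution lam \<Lambda> D2 p2 t2 \<and>
           negligible {z \<in> \<Lambda>. \<not> (returns lam \<Lambda> z \<and> z \<in> D1 \<and> transit_map lam p1 t1 z \<in> D2 \<and>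
              first_return lam \<Lambda> z = transit_map lam p2 t2 (transit_map lam p1 t1 z))} \<and>
           area_le (irregular_part lam p1 t1 D1) (K * lam ^ 3) \<and>
           area_le (irregular_part lam p2 t2 D2) (K * lam ^ 3))))"
  \<comment> \<open>The factor \<open>4\<close> is the area of the square \<open>[-1, 1]\<^sup>2\<close> that contains the ellipse of half-width \<open>1\<close>.\<close>
proof (rule exI[of _ 1], rule exI[of _ 4], intro conjI allI impI)
  fix lam :: real
  assume "0 < lam \<and> lam < 1"
  then interpret small_parameter lam
    by unfold_locales auto
  let ?p = Reflect_Last and ?t = "\<lambda>_. 1 :: nat"
  let ?D = "crossing_domain lam" and ?q = Reflect_First and ?s = "crossing_time lam"
  have composition: "{z \<in> wedge lam. \<not> (returns lam (wedge lam) z \<and> z \<in> wedge lam \<and>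
      transit_map lam ?p ?t z \<in> ?D \<and>
      first_return lam (wedge lam) z = transit_map lam ?q ?s (transit_map lam ?p ?t z))}
    = {z \<in> wedge lam. \<not> returns lam (wedge lam) z}"
    unfolding transit_map_flip transit_map_crossing
  proof (rule Collect_cong)
    fix z
    show "(z \<in> wedge lam \<and> \<not> (returns lam (wedge lam) z \<and> z \<in> wedge lam \<and> G (F lam z) \<in> ?D \<and>
        first_return lam (wedge lam) z = (F lam ^^ ?s (G (F lam z))) (G (G (F lam z)))))
      = (z \<in> wedge lam \<and> \<not> returns lam (wedge lam) z)"
      using returns_iff_flip[of z] first_return_eq[of z] by argo
  qed
  have empty: "area_le {} (4 * lam ^ 3)"
    using lam by (simp add: area_le_def)
  show "\<exists>\<Lambda>. planar_domain \<Lambda> \<and> \<Lambda> \<subseteq> Omega \<and> area_le \<Lambda> (4 * lam) \<and>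
        area_le {z \<in> Omega - main_island lam. F_orbit lam z \<inter> \<Lambda> = {}} (4 * lam\<^sup>2) \<and>
        (\<exists>D1 p1 t1 D2 p2 t2.
           pw_isometric_involution lam \<Lambda> D1 p1 t1 \<and>
           pw_isometric_involution lam \<Lambda> D2 p2 t2 \<and>
           negligible {z \<in> \<Lambda>. \<not> (returns lam \<Lambda> z \<and> z \<in> D1 \<and> transit_map lam p1 t1 z \<in> D2 \<and>
              first_return lam \<Lambda> z = transit_map lam p2 t2 (transit_map lam p1 t1 z))} \<and>
           area_le (irregular_part lam p1 t1 D1) (4 * lam ^ 3) \<and>
           area_le (irregular_part lam p2 t2 D2) (4 * lam ^ 3))"
  proof (rule exI[of _ "wedge lam"], intro conjI)
    show "planar_domain (wedge lam)"
      by (rule wedge_planar_domain)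
    show "wedge lam \<subseteq> Omega"
      using wedge_in_Omega by blast
    show "area_le (wedge lam) (4 * lam)"
      using wedge_area lam by (simp add: area_le_def)
    show "area_le {z \<in> Omega - main_island lam. F_orbit lam z \<inter> wedge lam = {}} (4 * lam\<^sup>2)"
      by (rule avoiding_set_area)
    show "\<exists>D1 p1 t1 D2 p2 t2.
           pw_isometric_involution lam (wedge lam) D1 p1 t1 \<and>
           pw_isometric_involution lam (wedge lam) D2 p2 t2 \<and>
           negligible {z \<in> wedge lam. \<not> (returns lam (wedge lam) z \<and> z \<in> D1 \<and> transit_map lam p1 t1 z \<in> D2 \<and>
              first_return lam (wedge lam) z = transit_map lam p2 t2 (transit_map lam p1 t1 z))} \<and>
           area_le (irregular_part lam p1 t1 D1) (4 * lam ^ 3) \<and>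
           area_le (irregular_part lam p2 t2 D2) (4 * lam ^ 3)"
    proof (rule exI[of _ "wedge lam"], rule exI[of _ ?p], rule exI[of _ ?t],
        rule exI[of _ ?D], rule exI[of _ ?q], rule exI[of _ ?s], intro conjI)
      show "pw_isometric_involution lam (wedge lam) (wedge lam) ?p ?t"
        by (rule flip_pw_isometric_involution)
      show "pw_isometric_involution lam (wedge lam) ?D ?q ?s"
        by (rule crossing_pw_isometric_involution[OF negligible_not_crossing])
      show "negligible {z \<in> wedge lam. \<not> (returns lam (wedge lam) z \<and> z \<in> wedge lam \<and>
          transit_map lam ?p ?t z \<in> ?D \<and>
          first_return lam (wedge lam) z = transit_map lam ?q ?s (transit_map lam ?p ?t z))}"
        unfolding composition by (rule negligible_not_returning)
      show "area_le (irregular_part lam ?p ?t (wedge lam)) (4 * lam ^ 3)"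
        unfolding flip_irregular_part by (rule empty)
      show "area_le (irregular_part lam ?q ?s ?D) (4 * lam ^ 3)"
        unfolding crossing_irregular_part by (rule empty)
    qed
  qed
qed simp

end
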